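(* For all $q,q'\in\mathcal Z_{\mathcal Q}^{p,m}$, we have $q\sqsubseteq_{\mathcal Z_{\mathcal Q}} q\sqcup_{\mathcal Z_{\mathcal Q}} q'$ and $q'\sqsubseteq_{\mathcal Z_{\mathcal Q}} q\sqcup_{\mathcal Z_{\mathcal Q}} q'$.
   Context: For $n\in\mathbb N$, $[n]=\{1,\dots,n\}$. Let $\mathcal C^m=[-1,1]^m\times[-1,1]\times[0,1]\times[-1,0]$; an element is written $t=(\epsilon,\epsilon_\pm,\epsilon_+,\epsilon_-)$ with $\epsilon=(\epsilon_1,\dots,\epsilon_m)$. A quadratic form with $m$ error terms is a tuple $q=(c,b,A,c_\pm,c_+,c_-)\in\mathbb R\times\mathbb R^m\times\mathbb R^{m\times m}\times\mathbb R_+\times\mathbb R_+\times\mathbb R_+$; the set of these is $\mathcal Q^m$. It is evaluated at $t\in\mathcal C^m$ by $q(t)=c+\sum_{i}b_i\epsilon_i+\sum_{i,j}A_{i,j}\epsilon_i\epsilon_j+c_\pm\epsilon_\pm+c_+\epsilon_++c_-\epsilon_-$, and $\gamma_{\mathcal Q}(q)=\{q(t):t\in\mathcal C^m\}$. Sums of quadratic forms are coefficientwise. For a closed bounded interval $[a,b]$, $\alpha_{\mathcal Q}([a,b])\in\mathcal Q^1$ has $c=(a+b)/2$, $b_1=(b-a)/2$, all other coefficients $0$; $\operatorname{mid}(S)$ is the midpoint of the smallest closed interval containing a bounded set $S\subseteq\mathbb R$. For $i,j\in\mathbb N$, $\operatorname{ext}_{i,j}:\mathcal Q^m\to\mathcal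 Q^{i+j+m}$ maps $(c,b,A,c_\pm,c_+,c_-)$ to $(c,b',A',c_\pm,c_+,c_-)$ with $b'_k=b_{k-i}$ if $i+1\le k\le m+i$ and $0$ otherwise, $A'_{k,l}=A_{k-i,l-i}$ if $i+1\le k,l\le m+i$ and $0$ otherwise. Quadratic vectors: $\mathcal Z_{\mathcal Q}^{p,m}=(\mathcal Q^m)^p$, with $\gamma_{\mathcal Z_{\mathcal Q}}(q)=\{x\in\mathbb R^p:\exists t\in\mathcal C^m,\ \forall k\in[p],\ x_k=q_k(t)\}$, and preorder $x\sqsubseteq_{\mathcal Z_{\mathcal Q}}y\iff\gamma_{\mathcal Z_{\mathcal Q}}(x)\subseteq\gamma_{\mathcal Z_{\mathcal Q}}(y)$ (defined also between quadratic vectors with different numbers of error terms). For $a\in\mathbb R$, $\operatorname{sgn}(a)=1$ if $a\ge0$ and $-1$ otherwise; $\operatorname{argmin}(a,b)=\operatorname{sgn}(a)\min(|a|,|b|)$ if $ab\ge0$ and $0$ otherwise. The upper bound $\sqcup_{\mathcal Z_{\mathcal Q}}:\mathcal Z_{\mathcal Q}^{p,m}\times\mathcal Z_{\mathcal Q}^{p,m}\to\mathcal Z_{\mathcal Q}^{p,m+p}$ is defined by $q\sqcup_{\mathcal Z_{\mathcal Q}}q'=\big(\operatorname{ext}_{0,p}(q''_k)+q^e_k\big)_{k\in[p]}$, where for each $k\in[p]$, writing $q_k=(c,b,A,c_\pm,c_+,c_-)$, $q'_k=(c',b',A',c'_\pm,c'_+,c'_-)$: $q''_k=(c'',b'',A'',c''_\pm,c''_+,c''_-)$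 with $c''=\operatorname{mid}(\gamma_{\mathcal Q}(q_k)\cup\gamma_{\mathcal Q}(q'_k))$, $c''_t=\operatorname{argmin}(c_t,c'_t)$ for $t\in\{\pm,+,-\}$, $b''_i=\operatorname{argmin}(b_i,b'_i)$, $A''_{i,j}=\operatorname{argmin}(A_{i,j},A'_{i,j})$; and $q^e_k=\operatorname{ext}_{m+k-1,p-k}(\alpha_{\mathcal Q}(H_k))$ where $H_k$ is the smallest closed interval containing $C_k\cup C'_k$, with $C_k=\{q_k(t)-q''_k(t):t\in\mathcal C^m\}$ and $C'_k=\{q'_k(t)-q''_k(t):t\in\mathcal C^m\}$. *)

theory Defs
  imports Complex_Main "HOL-Library.FuncSet"
begin

text \<open>
  Indices are 1-based. A vector in \<open>\<real>\<^sup>n\<close> is a function in \<open>{1..n} \<rightarrow>\<^sub>E UNIV\<close> and an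
  \<open>m \<times> m\<close> matrix a function on \<open>{1..m} \<times> {1..m}\<close>; functions are \<open>undefined\<close> outside their
  index set, so these sets are in bijection with the sets of tuples and matrices they stand for.
  As dimensions are not part of the types, operations take them as explicit arguments.
\<close>

type_synonym point = "(nat \<Rightarrow> real) \<times> real \<times> real \<times> real"
type_synonym qform = "real \<times> (nat \<Rightarrow> real) \<times> (nat \<times> nat \<Rightarrow> real) \<times> real \<times> real \<times> real"

definition cube :: "nat \<Rightarrow> point set" where
  "cube m = ({1..m} \<rightarrow>\<^sub>E {-1..1}) \<times> {-1..1} \<times> {0..1} \<times> {-1..0}"

definition Q :: "nat \<Rightarrow> qform set" where
  "Q m = UNIV \<times> ({1..m} \<rightarrow>\<^sub>E UNIV) \<times> ({1..m} \<times> {1..m} \<rightarrow>\<^sub>E UNIV) \<times> {0..} \<times> {0..} \<times> {0..}"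

fun evalQ :: "nat \<Rightarrow> qform \<Rightarrow> point \<Rightarrow> real" where
  "evalQ m (c, b, A, cpm, cp, cn) (e, epm, ep, en) =
     c + (\<Sum>i\<in>{1..m}. b i * e i) + (\<Sum>i\<in>{1..m}. \<Sum>j\<in>{1..m}. A (i, j) * e i * e j)
       + cpm * epm + cp * ep + cn * en"

definition gammaQ :: "nat \<Rightarrow> qform \<Rightarrow> real set" where
  "gammaQ m q = {evalQ m q t | t. t \<in> cube m}"

fun addQ :: "nat \<Rightarrow> qform \<Rightarrow> qform \<Rightarrow> qform" where
  "addQ m (c, b, A, cpm, cp, cn) (c', b', A', cpm', cp', cn') =
     (c + c', (\<lambda>i\<in>{1..m}. b i + b' i), (\<lambda>ij\<in>{1..m} \<times> {1..m}. A ij + A' ij),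
      cpm + cpm', cp + cp', cn + cn')"

definition interval_hull :: "real set \<Rightarrow> real set" where
  "interval_hull S = \<Inter> {{a..b} | a b. S \<subseteq> {a..b}}"

lemma interval_hull_eq:
  assumes "S \<noteq> {}" "bdd_below S" "bdd_above S"
  shows "interval_hull S = {Inf S..Sup S}"
proof
  have "S \<subseteq> {Inf S..Sup S}"
    using assms by (auto intro: cInf_lower cSup_upper)
  then show "interval_hull S \<subseteq> {Inf S..Sup S}"
    unfolding interval_hull_def by blast
  show "{Inf S..Sup S} \<subseteq> interval_hull S"
  proof
    fix x assume x: "x \<in> {Inf S..Sup S}"
    have "x \<in> {a..b}" if ab: "S \<subseteq> {a..b}" for a b
    proof -
      have "a \<le> Inf S" "Sup S \<le> b"
        using assms(1) ab by (auto intro!: cInf_greatest cSup_least)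
      with x show ?thesis by auto
    qed
    then show "x \<in> interval_hull S"
      unfolding interval_hull_def by blast
  qed
qed

definition mid :: "real set \<Rightarrow> real" where
  "mid S = (Inf (interval_hull S) + Sup (interval_hull S)) / 2"

text \<open>The argument of \<open>alphaQ\<close> is a nonempty closed bounded interval.\<close>

definition alphaQ :: "real set \<Rightarrow> qform" where
  "alphaQ I = ((Inf I + Sup I) / 2, (\<lambda>i\<in>{1..1}. (Sup I - Inf I) / 2), (\<lambda>ij\<in>{1..1} \<times> {1..1}. 0), 0, 0, 0)"

lemma alphaQ_interval:
  "a \<le> b \<Longrightarrow> alphaQ {a..b} = ((a + b) / 2, (\<lambda>i\<in>{1..1}. (b - a) / 2), (\<lambda>ij\<in>{1..1} \<times> {1..1}. 0), 0, 0, 0)"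
  by (simp add: alphaQ_def)

text \<open>\<open>extQ m i j\<close> is the map \<open>ext\<^bsub>i,j\<^esub>\<close> from \<open>Q m\<close> to \<open>Q (i + j + m)\<close>.\<close>

fun extQ :: "nat \<Rightarrow> nat \<Rightarrow> nat \<Rightarrow> qform \<Rightarrow> qform" where
  "extQ m i j (c, b, A, cpm, cp, cn) =
     (c,
      (\<lambda>k\<in>{1..i + j + m}. if k \<in> {i + 1..m + i} then b (k - i) else 0),
      (\<lambda>(k, l)\<in>{1..i + j + m} \<times> {1..i + j + m}.
         if k \<in> {i + 1..m + i} \<and> l \<in> {i + 1..m + i} then A (k - i, l - i) else 0),
      cpm, cp, cn)"

definition ZQ :: "nat \<Rightarrow> nat \<Rightarrow> (nat \<Rightarrow> qform) set" where
  "ZQ p m = {1..p} \<rightarrow>\<^sub>E Q m"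

definition gammaZQ :: "nat \<Rightarrow> nat \<Rightarrow> (nat \<Rightarrow> qform) \<Rightarrow> (nat \<Rightarrow> real) set" where
  "gammaZQ p m q = {x \<in> {1..p} \<rightarrow>\<^sub>E UNIV. \<exists>t\<in>cube m. \<forall>k\<in>{1..p}. x k = evalQ m (q k) t}"

text \<open>\<open>leZQ p m m' x y\<close> compares \<open>x\<close> with \<open>m\<close> error terms and \<open>y\<close> with \<open>m'\<close> error terms.\<close>

definition leZQ :: "nat \<Rightarrow> nat \<Rightarrow> nat \<Rightarrow> (nat \<Rightarrow> qform) \<Rightarrow> (nat \<Rightarrow> qform) \<Rightarrow> bool" where
  "leZQ p m m' x y \<longleftrightarrow> gammaZQ p m x \<subseteq> gammaZQ p m' y"

text \<open>Unlike the library's \<^const>\<open>sgn\<close>, the sign used here is \<open>1\<close> at \<open>0\<close>.\<close>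

definition sgn1 :: "real \<Rightarrow> real" where
  "sgn1 a = (if a \<ge> 0 then 1 else -1)"

definition argmin :: "real \<Rightarrow> real \<Rightarrow> real" where
  "argmin a b = (if a * b \<ge> 0 then sgn1 a * min \<bar>a\<bar> \<bar>b\<bar> else 0)"

text \<open>\<open>common m q\<^sub>k q'\<^sub>k\<close> is \<open>q''\<^sub>k\<close>, and \<open>error p m k q\<^sub>k q'\<^sub>k\<close> is \<open>q\<^sup>e\<^sub>k\<close>.\<close>

fun common :: "nat \<Rightarrow> qform \<Rightarrow> qform \<Rightarrow> qform" where
  "common m (c, b, A, cpm, cp, cn) (c', b', A', cpm', cp', cn') =
     (mid (gammaQ m (c, b, A, cpm, cp, cn) \<union> gammaQ m (c', b', A', cpm', cp', cn')),
      (\<lambda>i\<in>{1..m}. argmin (b i) (b' i)),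
      (\<lambda>ij\<in>{1..m} \<times> {1..m}. argmin (A ij) (A' ij)),
      argmin cpm cpm', argmin cp cp', argmin cn cn')"

definition diff_hull :: "nat \<Rightarrow> qform \<Rightarrow> qform \<Rightarrow> real set" where
  "diff_hull m q q' = interval_hull
     ({evalQ m q t - evalQ m (common m q q') t | t. t \<in> cube m} \<union>
      {evalQ m q' t - evalQ m (common m q q') t | t. t \<in> cube m})"

definition error :: "nat \<Rightarrow> nat \<Rightarrow> nat \<Rightarrow> qform \<Rightarrow> qform \<Rightarrow> qform" where
  "error p m k q q' = extQ 1 (m + k - 1) (p - k) (alphaQ (diff_hull m q q'))"

definition joinZQ :: "nat \<Rightarrow> nat \<Rightarrow> (nat \<Rightarrow> qform) \<Rightarrow> (nat \<Rightarrow> qform) \<Rightarrow> (nat \<Rightarrow> qform)" where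
  "joinZQ p m q q' =
     (\<lambda>k\<in>{1..p}. addQ (m + p) (extQ m 0 p (common m (q k) (q' k))) (error p m k (q k) (q' k)))"

lemma argmin_nonneg: "a \<ge> 0 \<Longrightarrow> argmin a b \<ge> 0"
  by (simp add: argmin_def sgn1_def)

lemma joinZQ_in_ZQ:
  assumes "q \<in> ZQ p m" "q' \<in> ZQ p m"
  shows "joinZQ p m q q' \<in> ZQ p (m + p)"
proof -
  have "addQ (m + p) (extQ m 0 p (common m (q k) (q' k))) (error p m k (q k) (q' k)) \<in> Q (m + p)"
    if k: "k \<in> {1..p}" for k
  proof -
    have "q k \<in> Q m" "q' k \<in> Q m"
      using assms k by (auto simp: ZQ_def PiE_iff)
    then show ?thesis
      by (cases "q k"; cases "q' k")
        (auto simp: Q_def error_def alphaQ_def argmin_nonneg)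
  qed
  then show ?thesis
    by (auto simp: ZQ_def joinZQ_def)
qed

end

theory Submission
  imports Defs
begin

text \<open>
  Keep the error terms \<open>t\<close> that witness a point of \<open>q\<close> (or \<open>q'\<close>). The \<open>k\<close>-th coordinate of the
  join has an error term of its own, which no other coordinate uses and which ranges over an
  interval containing the discrepancy \<open>q\<^sub>k(t) - q''\<^sub>k(t)\<close>; these \<open>p\<close> error terms can therefore be
  chosen independently so as to cancel all discrepancies at once. The interval hulls
  are genuine intervals because quadratic forms are bounded on the cube.
\<close>

text \<open>Reindexing for \<open>evalQ_extQ\<close>: coefficients padded by \<open>extQ\<close>
  vanish outside this window, and shifting the window by \<open>i\<close> recovers the original
  sum.\<close>

lemma sum_shifted_window:
  fixes g :: "nat \<Rightarrow> 'a::comm_monoid_add"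
  shows "(\<Sum>k\<in>{1..i + j + m}. if k \<in> {i + 1..m + i} then g k else 0) = (\<Sum>k\<in>{1..m}. g (k + i))"
proof -
  have "(\<Sum>k\<in>{1..i + j + m}. if k \<in> {i + 1..m + i} then g k else 0) = (\<Sum>k\<in>{1 + i..m + i}. g k)"
    by (rule sum.mono_neutral_cong_right) auto
  also have "\<dots> = (\<Sum>k\<in>{1..m}. g (k + i))"
    by (rule sum.shift_bounds_cl_nat_ivl)
  finally show ?thesis .
qed

lemma evalQ_cong:
  assumes "\<And>i. i \<in> {1..m} \<Longrightarrow> e i = e' i"
  shows "evalQ m q (e, r) = evalQ m q (e', r)"
  by (cases q; cases r) (simp add: assms)

lemma evalQ_addQ: "evalQ m (addQ m q q') t = evalQ m q t + evalQ m q' t"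
  by (cases q; cases q'; cases t) (simp add: algebra_simps sum.distrib)

text \<open>Padding by zeros makes the form read its error terms at positions \<open>i + 1\<close>
  to \<open>i + m\<close>, whatever the other entries of \<open>e\<close> are.\<close>

lemma evalQ_extQ:
  "evalQ (i + j + m) (extQ m i j q) (e, r) = evalQ m q (\<lambda>k. e (k + i), r)"
proof -
  obtain c b A cpm cp cn where q: "q = (c, b, A, cpm, cp, cn)" by (cases q)
  obtain epm ep en where r: "r = (epm, ep, en)" by (cases r)
  let ?W = "{i + 1..m + i}" and ?N = "{1..i + j + m}"
  have lin: "(\<Sum>k\<in>?N. (if k \<in> ?W then b (k - i) else 0) * e k) = (\<Sum>k\<in>{1..m}. b k * e (k + i))"
    using sum_shifted_window[where i = i and j = j and m = m and g = "\<lambda>k. b (k - i) * e k"]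
    by (simp add: if_distrib[of "\<lambda>x. x * _"] cong: if_cong)
  \<comment> \<open>The inner sum is collapsed first, for fixed \<open>k\<close>; what remains is
    again supported on the window, so the same reindexing applies to the outer sum.\<close>
  have "(\<Sum>l\<in>?N. (if k \<in> ?W \<and> l \<in> ?W then A (k - i, l - i) else 0) * e k * e l) =
      (if k \<in> ?W then \<Sum>l\<in>{1..m}. A (k - i, l) * e k * e (l + i) else 0)" for k
    using sum_shifted_window[where i = i and j = j and m = m and g = "\<lambda>l. A (k - i, l - i) * e k * e l"]
    by (cases "k \<in> ?W") (simp_all del: atLeastAtMost_iff add: if_distrib[of "\<lambda>x. x * _"] cong: if_cong)
  then have quad: "(\<Sum>k\<in>?N. \<Sum>l\<in>?N. (if k \<in> ?W \<and> l \<in> ?W then A (k - i, l - i) else 0) * e k * e l) =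
      (\<Sum>k\<in>{1..m}. \<Sum>l\<in>{1..m}. A (k, l) * e (k + i) * e (l + i))"
    using sum_shifted_window[where i = i and j = j and m = m and g = "\<lambda>k. \<Sum>l\<in>{1..m}. A (k - i, l) * e k * e (l + i)"]
    by simp
  show ?thesis
    using lin quad by (simp add: q r del: atLeastAtMost_iff cong: sum.cong)
qed

lemma abs_mult_le_left:
  fixes x y :: real
  assumes "\<bar>y\<bar> \<le> 1"
  shows "\<bar>x * y\<bar> \<le> \<bar>x\<bar>"
  using mult_left_mono[OF assms, of "\<bar>x\<bar>"] by (simp add: abs_mult)

text \<open>Every error term has absolute value at most 1 on the cube, so the absolute values of the
  coefficients add up to a bound.\<close>

lemma evalQ_bounded: "\<exists>B. \<forall>t\<in>cube m. \<bar>evalQ m q t\<bar> \<le> B"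
proof -
  obtain c b A cpm cp cn where q: "q = (c, b, A, cpm, cp, cn)" by (cases q)
  let ?B = "\<bar>c\<bar> + (\<Sum>i\<in>{1..m}. \<bar>b i\<bar>) + (\<Sum>i\<in>{1..m}. \<Sum>j\<in>{1..m}. \<bar>A (i, j)\<bar>)
    + \<bar>cpm\<bar> + \<bar>cp\<bar> + \<bar>cn\<bar>"
  have "\<bar>evalQ m q t\<bar> \<le> ?B" if "t \<in> cube m" for t
  proof -
    obtain e epm ep en where t: "t = (e, epm, ep, en)" by (cases t)
    have e: "\<bar>e i\<bar> \<le> 1" if "i \<in> {1..m}" for i
      using \<open>t \<in> cube m\<close> that by (force simp: t cube_def abs_le_iff PiE_iff)
    have r: "\<bar>epm\<bar> \<le> 1" "\<bar>ep\<bar> \<le> 1" "\<bar>en\<bar> \<le> 1"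
      using \<open>t \<in> cube m\<close> by (auto simp: t cube_def)
    have lin: "\<bar>\<Sum>i\<in>{1..m}. b i * e i\<bar> \<le> (\<Sum>i\<in>{1..m}. \<bar>b i\<bar>)"
      by (rule order_trans[OF sum_abs sum_mono]) (rule abs_mult_le_left[OF e])
    have "\<bar>A (i, j) * e i * e j\<bar> \<le> \<bar>A (i, j)\<bar>" if "i \<in> {1..m}" "j \<in> {1..m}" for i j
      using abs_mult_le_left[OF e, OF that(2), of "A (i, j) * e i"]
        abs_mult_le_left[OF e, OF that(1), of "A (i, j)"] by linarith
    then have quad: "\<bar>\<Sum>i\<in>{1..m}. \<Sum>j\<in>{1..m}. A (i, j) * e i * e j\<bar> \<le>
        (\<Sum>i\<in>{1..m}. \<Sum>j\<in>{1..m}. \<bar>A (i, j)\<bar>)"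
      by (intro order_trans[OF sum_abs sum_mono]) auto
    show ?thesis
      unfolding q t evalQ.simps
      using lin quad abs_mult_le_left[OF r(1), of cpm] abs_mult_le_left[OF r(2), of cp]
        abs_mult_le_left[OF r(3), of cn] by linarith
  qed
  then show ?thesis by blast
qed

text \<open>The point \<open>t\<close> also shows the set of differences to be nonempty, which
  \<open>interval_hull_eq\<close> requires besides boundedness.\<close>

lemma diff_hull_interval:
  assumes "t \<in> cube m"
  obtains a b where "diff_hull m q q' = {a..b}"
    "evalQ m q t - evalQ m (common m q q') t \<in> {a..b}"
    "evalQ m q' t - evalQ m (common m q q') t \<in> {a..b}"
proof -
  let ?c = "common m q q'"
  let ?S = "{evalQ m q t - evalQ m ?c t | t. t \<in> cube m} \<union> {evalQ m q' t - evalQ m ?c t | t. t \<in> cube m}"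
  obtain B B' B'' where B: "\<And>t. t \<in> cube m \<Longrightarrow> \<bar>evalQ m q t\<bar> \<le> B"
      "\<And>t. t \<in> cube m \<Longrightarrow> \<bar>evalQ m q' t\<bar> \<le> B'" "\<And>t. t \<in> cube m \<Longrightarrow> \<bar>evalQ m ?c t\<bar> \<le> B''"
    using evalQ_bounded by metis
  have "\<bar>x\<bar> \<le> B + B' + B''" if "x \<in> ?S" for x
  proof -
    obtain u where u: "u \<in> cube m"
        "x = evalQ m q u - evalQ m ?c u \<or> x = evalQ m q' u - evalQ m ?c u"
      using \<open>x \<in> ?S\<close> by blast
    then show ?thesis using B[OF u(1)] by linarith
  qed
  then have "- (B + B' + B'') \<le> x \<and> x \<le> B + B' + B''" if "x \<in> ?S" for x
    using that by (fastforce simp: abs_le_iff)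
  then have bdd: "bdd_below ?S" "bdd_above ?S"
    by (meson bdd_belowI, meson bdd_aboveI)
  have mem: "evalQ m q t - evalQ m ?c t \<in> ?S" "evalQ m q' t - evalQ m ?c t \<in> ?S"
    using assms by blast+
  show ?thesis
  proof (rule that)
    show "diff_hull m q q' = {Inf ?S..Sup ?S}"
      unfolding diff_hull_def using mem(1) by (intro interval_hull_eq bdd) blast
    show "evalQ m q t - evalQ m ?c t \<in> {Inf ?S..Sup ?S}"
      using cInf_lower[OF mem(1) bdd(1)] cSup_upper[OF mem(1) bdd(2)] by (rule atLeastAtMost_iff[THEN iffD2, OF conjI])
    show "evalQ m q' t - evalQ m ?c t \<in> {Inf ?S..Sup ?S}"
      using cInf_lower[OF mem(2) bdd(1)] cSup_upper[OF mem(2) bdd(2)] by (rule atLeastAtMost_iff[THEN iffD2, OF conjI])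
  qed
qed

text \<open>The right-hand side is the linear form given by \<open>alphaQ {a..b}\<close>, evaluated
  at the error term \<open>s\<close>.\<close>

lemma interval_affine_param:
  fixes a b d :: real
  assumes "d \<in> {a..b}"
  obtains s where "s \<in> {-1..1}" "d = (a + b) / 2 + (b - a) / 2 * s"
proof (cases "a = b")
  case True
  \<comment> \<open>The slope is 0 here, so any \<open>s\<close> would do.\<close>
  then show ?thesis using assms that[of 0] by simp
next
  case False
  with assms have "a < b" by auto
  with assms show ?thesis
    by (intro that[of "(2 * d - a - b) / (b - a)"]) (auto simp: field_simps)
qed

text \<open>Here \<open>r\<close> stands for either argument of the join, so both inequalities are
  instances of one argument.\<close>

lemma leZQ_joinZQ_I:
  assumes "\<And>k t. k \<in> {1..p} \<Longrightarrow> t \<in> cube m \<Longrightarrow>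
    \<exists>a b. diff_hull m (q k) (q' k) = {a..b} \<and>
      evalQ m (r k) t - evalQ m (common m (q k) (q' k)) t \<in> {a..b}"
  shows "leZQ p m (m + p) r (joinZQ p m q q')"
proof -
  have "x \<in> gammaZQ p (m + p) (joinZQ p m q q')" if x: "x \<in> gammaZQ p m r" for x
  proof -
    obtain e w where t: "(e, w) \<in> cube m" and xt: "\<And>k. k \<in> {1..p} \<Longrightarrow> x k = evalQ m (r k) (e, w)"
      and x_ext: "x \<in> {1..p} \<rightarrow>\<^sub>E UNIV"
      using x by (auto simp: gammaZQ_def)
    let ?c = "\<lambda>k. common m (q k) (q' k)"
    let ?H = "\<lambda>k. diff_hull m (q k) (q' k)"
    have "\<exists>s\<in>{-1..1}. evalQ m (r k) (e, w) - evalQ m (?c k) (e, w) =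
        (Inf (?H k) + Sup (?H k)) / 2 + (Sup (?H k) - Inf (?H k)) / 2 * s" if k: "k \<in> {1..p}" for k
    proof -
      obtain a b where H: "?H k = {a..b}"
        and d: "evalQ m (r k) (e, w) - evalQ m (?c k) (e, w) \<in> {a..b}"
        using assms[OF k t] by blast
      then have "Inf (?H k) = a" "Sup (?H k) = b" by simp_all
      then show ?thesis using interval_affine_param[OF d] by metis
    qed
    then obtain s where s: "\<And>k. k \<in> {1..p} \<Longrightarrow> s k \<in> {-1..1}"
      and ds: "\<And>k. k \<in> {1..p} \<Longrightarrow> evalQ m (r k) (e, w) - evalQ m (?c k) (e, w) =
        (Inf (?H k) + Sup (?H k)) / 2 + (Sup (?H k) - Inf (?H k)) / 2 * s k"
      by metis
    \<comment> \<open>The old error terms come first, and position \<open>m + k\<close> holds the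
      one reserved for coordinate \<open>k\<close>. The restricted \<open>\<lambda>\<close> keeps
      \<open>e'\<close> extensional, as membership in \<open>cube (m + p)\<close> demands.\<close>
    define e' where "e' = (\<lambda>i\<in>{1..m + p}. if i \<le> m then e i else s (i - m))"
    have e'_mem: "e' i \<in> {-1..1}" if "i \<in> {1..m + p}" for i
    proof (cases "i \<le> m")
      case True
      with that t show ?thesis by (simp add: e'_def cube_def PiE_iff)
    next
      case False
      with that have "i - m \<in> {1..p}" by auto
      from s[OF this] show ?thesis using that False by (simp add: e'_def)
    qed
    have "(e', w) \<in> cube (m + p)"
      using t e'_mem by (auto simp: cube_def e'_def PiE_iff)
    moreover have "x k = evalQ (m + p) (joinZQ p m q q' k) (e', w)" if k: "k \<in> {1..p}" for k
    proof -
      have "evalQ (m + p) (extQ m 0 p (?c k)) (e', w) = evalQ m (?c k) (e', w)"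
        using evalQ_extQ[of 0 p m "?c k" e' w] by (simp add: add.commute)
      also have "\<dots> = evalQ m (?c k) (e, w)"
        by (rule evalQ_cong) (simp add: e'_def)
      finally have common: "evalQ (m + p) (extQ m 0 p (?c k)) (e', w) = evalQ m (?c k) (e, w)" .
      \<comment> \<open>No subtraction truncates, as \<open>k\<close> lies between 1 and
        \<open>p\<close>. The offset \<open>m + k - 1\<close> sends the only error term of
        \<open>alphaQ\<close>, at index 1, to position \<open>m + k\<close>, where \<open>e'\<close>
        equals \<open>s k\<close>.\<close>
      have "m + p = (m + k - 1) + (p - k) + 1" using k by auto
      then have "evalQ (m + p) (error p m k (q k) (q' k)) (e', w) =
          evalQ 1 (alphaQ (?H k)) (\<lambda>i. e' (i + (m + k - 1)), w)"
        by (simp only: error_def evalQ_extQ)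
      also have "\<dots> = (Inf (?H k) + Sup (?H k)) / 2 + (Sup (?H k) - Inf (?H k)) / 2 * s k"
        using k by (cases w) (auto simp: alphaQ_def e'_def)
      finally show ?thesis
        using common ds[OF k] k by (simp add: joinZQ_def evalQ_addQ xt)
    qed
    ultimately show ?thesis using x_ext by (auto simp: gammaZQ_def)
  qed
  then show ?thesis by (auto simp: leZQ_def)
qed

theorem mainTheorem2:
  fixes p m :: nat and q q' :: "nat \<Rightarrow> qform"
  assumes "q \<in> ZQ p m" and "q' \<in> ZQ p m"
  shows "leZQ p m (m + p) q (joinZQ p m q q') \<and> leZQ p m (m + p) q' (joinZQ p m q q')"
  by (intro conjI leZQ_joinZQ_I) (metis diff_hull_interval)+

end
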